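(* There are no infinite torsion groups among the groups $G(A)$, where $A$ ranges over all invertible automata with $3$ states over a $2$-letter alphabet. That is, if $A$ is such an automaton and every element of $G(A)$ has finite order, then $G(A)$ is finite.
   Context: A finite invertible automaton is a quadruple $A=(Q,X,\tau,\rho)$ where $Q$ is a finite set of states, $X$ is a finite alphabet, $\tau:Q\times X\to Q$ and $\rho:Q\times X\to X$ are maps such that for each $q\in Q$ the map $\rho_q:X\to X$, $\rho_q(x)=\rho(q,x)$, is a permutation of $X$. Each state $q$ defines an automorphism, also denoted $q$, of the rooted tree $X^*$ of finite words over $X$, recursively by $q(\emptyset)=\emptyset$ and $q(xw)=\rho_q(x)\,\tau(q,x)(w)$ for $x\in X$, $w\in X^*$. The automaton group $G(A)$ is the subgroup of $\mathrm{Aut}(X^* )$ generated by the automorphisms defined by the states. Here $|Q|=3$ and $|X|=2$; distinct states are allowed to define the same automorphism. *)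

theory Defs
  imports "HOL-Algebra.Generated_Groups" "HOL-Library.Cardinality"
begin

text \<open>The state set and the alphabet of an automaton are the finite types \<open>'q\<close> and \<open>'x\<close>;
  the words over the alphabet are then exactly the elements of \<open>'x list\<close>.\<close>

record ('q, 'x) automaton =
  next_state :: "'q \<Rightarrow> 'x \<Rightarrow> 'q"
  out_letter :: "'q \<Rightarrow> 'x \<Rightarrow> 'x"

definition invertible_automaton :: "('q::finite, 'x::finite) automaton \<Rightarrow> bool" where
  "invertible_automaton A \<longleftrightarrow> (\<forall>q. bij (out_letter A q))"

primrec state_map :: "('q, 'x) automaton \<Rightarrow> 'q \<Rightarrow> 'x list \<Rightarrow> 'x list" where
  "state_map A q [] = []"
| "state_map A q (x # w) = out_letter A q x # state_map A (next_state A q x) w"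

definition tree_adj :: "'x list \<Rightarrow> 'x list \<Rightarrow> bool" where
  "tree_adj u v \<longleftrightarrow> (\<exists>x. v = u @ [x] \<or> u = v @ [x])"

definition tree_Aut :: "('x list \<Rightarrow> 'x list) monoid" where
  "tree_Aut = \<lparr>carrier = {f. bij f \<and> f [] = [] \<and> (\<forall>u v. tree_adj (f u) (f v) \<longleftrightarrow> tree_adj u v)},
    mult = (\<circ>), one = id\<rparr>"

definition automaton_group :: "('q, 'x) automaton \<Rightarrow> ('x list \<Rightarrow> 'x list) monoid" where
  "automaton_group A = tree_Aut\<lparr>carrier := generate tree_Aut (range (state_map A))\<rparr>"

definition torsion_group :: "('a, 'b) monoid_scheme \<Rightarrow> bool" where
  "torsion_group G \<longleftrightarrow> group G \<and> (\<forall>g\<in>carrier G. \<exists>n::nat. n > 0 \<and> g [^]\<^bsub>G\<^esub> n = \<one>\<^bsub>G\<^esub>)"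

lemma group_tree_Aut: "group (tree_Aut :: ('x list \<Rightarrow> 'x list) monoid)"
proof (rule groupI)
  fix f :: "'x list \<Rightarrow> 'x list"
  assume "f \<in> carrier tree_Aut"
  then have f: "bij f" "f [] = []" "\<And>u v. tree_adj (f u) (f v) \<longleftrightarrow> tree_adj u v"
    by (auto simp: tree_Aut_def)
  have s: "f (inv_into UNIV f u) = u" for u
    using f(1) by (simp add: bij_is_surj surj_f_inv_f)
  have "inv_into UNIV f \<in> carrier tree_Aut"
    using f(1) f(3)[of "inv_into UNIV f _" "inv_into UNIV f _"] inv_f_f[OF bij_is_inj[OF f(1)], of "[]"]
    by (simp add: tree_Aut_def bij_imp_bij_inv f(2) s)
  moreover have "inv_into UNIV f \<circ> f = id"
    using f(1) by (simp add: bij_is_inj)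
  ultimately show "\<exists>g\<in>carrier tree_Aut. g \<otimes>\<^bsub>tree_Aut\<^esub> f = \<one>\<^bsub>tree_Aut\<^esub>"
    by (auto simp: tree_Aut_def)
qed (auto simp: tree_Aut_def bij_comp comp_assoc)

lemma length_state_map [simp]: "length (state_map A q w) = length w"
  by (induction w arbitrary: q) auto

lemma state_map_snoc: "\<exists>y. state_map A q (w @ [x]) = state_map A q w @ [y]"
  by (induction w arbitrary: q) auto

lemma bij_state_map:
  assumes "invertible_automaton A"
  shows "bij (state_map A q)"
proof (rule bijI)
  have b: "bij (out_letter A q)" for q
    using assms by (simp add: invertible_automaton_def)
  have i: "out_letter A q x = out_letter A q y \<longleftrightarrow> x = y" for q x y
    using b[of q] by (meson bij_is_inj injD)
  show "inj (state_map A q)"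
  proof (rule injI)
    fix u v assume "state_map A q u = state_map A q v"
    then show "u = v"
    proof (induction u arbitrary: q v)
      case Nil
      then show ?case by (cases v) auto
    next
      case (Cons x u)
      then show ?case by (cases v) (auto simp: i)
    qed
  qed
  have "\<exists>u. state_map A q u = v" for v
  proof (induction v arbitrary: q)
    case Nil
    then show ?case by (auto intro: exI[of _ "[]"])
  next
    case (Cons y v)
    obtain x where x: "out_letter A q x = y"
      using b[of q] by (metis bij_pointE)
    obtain u where "state_map A (next_state A q x) u = v"
      using Cons by blast
    then show ?case using x by (intro exI[of _ "x # u"]) auto
  qed
  then show "surj (state_map A q)" by (metis surjI)
qed

lemma state_map_in_tree_Aut:
  assumes "invertible_automaton A"
  shows "state_map A q \<in> carrier tree_Aut"
proof -
  have inj: "state_map A q u = state_map A q v \<longleftrightarrow> u = v" for u v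
    using bij_state_map[OF assms, of q] by (meson bij_is_inj injD)
  have *: "(\<exists>y. state_map A q v = state_map A q u @ [y]) \<longleftrightarrow> (\<exists>x. v = u @ [x])" for u v
  proof
    assume "\<exists>y. state_map A q v = state_map A q u @ [y]"
    then obtain y where y: "state_map A q v = state_map A q u @ [y]" by blast
    then have "v \<noteq> []" by auto
    then obtain w x where v: "v = w @ [x]" by (metis rev_exhaust)
    show "\<exists>x. v = u @ [x]"
      using y v inj state_map_snoc[of A q w x] by auto
  qed (use state_map_snoc in fastforce)
  have "tree_adj (state_map A q u) (state_map A q v) \<longleftrightarrow> tree_adj u v" for u v
    unfolding tree_adj_def ex_disj_distrib * ..
  then show ?thesis
    using bij_state_map[OF assms] by (simp add: tree_Aut_def)
qed

lemma group_automaton_group: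
  assumes "invertible_automaton A"
  shows "group (automaton_group A)"
  unfolding automaton_group_def
  using group.generate_is_subgroup[OF group_tree_Aut] state_map_in_tree_Aut[OF assms]
    subgroup.subgroup_is_group[OF _ group_tree_Aut] by blast

end

(* If all states have the same activity, the group is finite by item 1 below. Otherwise one may
   relabel the states and letters so that the activity pattern is (0,0,1) or (0,1,1), which leaves
   2 * 729 automata. Each of them is settled by one of five arguments, selected by a computation.
   1. Below the first level the activity of a state depends only on the level: then an element is
      determined by its activity and by two sums of level sequences, and the group is finite.
   2. The number of active sections of some word on every level is odd, so the word acts as an
      odometer and has infinite order.
   3. A single changed letter of the input travels a fixed distance to the right at every application
      of a word, so no power of the word is trivial.
   4. One state is trivial and the other two are involutions p, r: since pr has finite order, the
      group is finite dihedral.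
   5. For some word, following the sections of the word or, if it is active, of its square leads back
      to a conjugate of the word with at least one squaring on the way; a finite order of the word
      would therefore be at most half of itself. *)

theory Submission
  imports Defs
begin

section \<open>Words of states of a binary automaton\<close>

text \<open>A permutation of two letters is the identity or the swap, so the Boolean
  \<open>act q\<close> replaces it and \<open>\<noteq>\<close> is exclusive or.\<close>

primrec smap :: "('q \<Rightarrow> bool) \<Rightarrow> ('q \<Rightarrow> bool \<Rightarrow> 'q) \<Rightarrow> 'q \<Rightarrow> bool list \<Rightarrow> bool list" where
  "smap act nxt q [] = []"
| "smap act nxt q (x # w) = (x \<noteq> act q) # smap act nxt (nxt q x) w"

text \<open>The head of the list acts first, so concatenation reverses composition.\<close>

primrec run :: "('q \<Rightarrow> bool) \<Rightarrow> ('q \<Rightarrow> bool \<Rightarrow> 'q) \<Rightarrow> 'q list \<Rightarrow> bool list \<Rightarrow> bool list" where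
  "run act nxt [] w = w"
| "run act nxt (q # ws) w = run act nxt ws (smap act nxt q w)"

primrec wact :: "('q \<Rightarrow> bool) \<Rightarrow> 'q list \<Rightarrow> bool" where
  "wact act [] = False"
| "wact act (q # ws) = (if act q then \<not> wact act ws else wact act ws)"

primrec wsec :: "('q \<Rightarrow> bool) \<Rightarrow> ('q \<Rightarrow> bool \<Rightarrow> 'q) \<Rightarrow> 'q list \<Rightarrow> bool \<Rightarrow> 'q list" where
  "wsec act nxt [] x = []"
| "wsec act nxt (q # ws) x = nxt q x # wsec act nxt ws (if act q then \<not> x else x)"

abbreviation reach :: "('q \<Rightarrow> bool \<Rightarrow> 'q) \<Rightarrow> 'q \<Rightarrow> bool list \<Rightarrow> 'q" where
  "reach nxt \<equiv> foldl nxt"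

text \<open>Words without inverses suffice, since in a torsion group inverses are positive
  powers.\<close>

definition torsion_on :: "('q \<Rightarrow> bool) \<Rightarrow> ('q \<Rightarrow> bool \<Rightarrow> 'q) \<Rightarrow> bool" where
  "torsion_on act nxt \<longleftrightarrow> (\<forall>ws. \<exists>k>0. run act nxt ws ^^ k = id)"

section \<open>Sections and orders of words\<close>

lemma length_smap [simp]: "length (smap act nxt q w) = length w"
  by (induction w arbitrary: q) auto

lemma smap_append:
  "smap act nxt q (u @ v) = smap act nxt q u @ smap act nxt (reach nxt q u) v"
  by (induction u arbitrary: q) auto

lemma surj_smap: "\<exists>u. smap act nxt q u = v"
proof (induction v arbitrary: q)
  case Nil
  then show ?case by (auto intro: exI[of _ "[]"])
next
  case (Cons y v)
  obtain u where "smap act nxt (nxt q (y \<noteq> act q)) u = v" using Cons by blast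
  then show ?case by (intro exI[of _ "(y \<noteq> act q) # u"]) auto
qed

lemma length_run [simp]: "length (run act nxt ws w) = length w"
  by (induction ws arbitrary: w) auto

lemma run_append: "run act nxt (u @ v) w = run act nxt v (run act nxt u w)"
  by (induction u arbitrary: w) auto

lemma run_Nil_right [simp]: "run act nxt ws [] = []"
  by (induction ws) auto

lemma run_pow_Nil [simp]: "(run act nxt ws ^^ k) [] = []"
  by (induction k) auto

lemma run_Cons_right:
  "run act nxt ws (x # w) = (x \<noteq> wact act ws) # run act nxt (wsec act nxt ws x) w"
proof (induction ws arbitrary: x w)
  case (Cons q ws)
  have "(x \<noteq> act q) = (if act q then \<not> x else x)" by auto
  then show ?case by (simp add: Cons)
qed auto

lemma run_concat_replicate: "run act nxt (concat (replicate n ws)) = run act nxt ws ^^ n"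
proof (induction n)
  case (Suc n)
  then show ?case
    by (auto simp: run_append fun_eq_iff funpow_swap1)
qed (auto simp: fun_eq_iff)

lemma run_pow_inactive:
  assumes "\<not> wact act ws"
  shows "(run act nxt ws ^^ k) (x # w) = x # (run act nxt (wsec act nxt ws x) ^^ k) w"
  by (induction k) (use assms in \<open>auto simp: run_Cons_right\<close>)

text \<open>The square of an active word fixes the first letter; its section there is the product of
  both sections of the word.\<close>

lemma run_pow_active:
  assumes "wact act ws"
  shows "(run act nxt ws ^^ (2 * j)) (x # w) =
    x # (run act nxt (wsec act nxt ws x @ wsec act nxt ws (\<not> x)) ^^ j) w"
  by (induction j) (use assms in \<open>auto simp: run_Cons_right run_append\<close>)

lemma inactive_section_order:
  assumes "\<not> wact act ws" "run act nxt ws ^^ k = id"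
  shows "run act nxt (wsec act nxt ws x) ^^ k = id"
proof
  fix w
  show "(run act nxt (wsec act nxt ws x) ^^ k) w = id w"
    using run_pow_inactive[OF assms(1), where nxt = nxt and k = k and x = x and w = w] assms(2) by simp
qed

lemma active_section_order:
  assumes "wact act ws" "run act nxt ws ^^ k = id"
  shows "even k" "run act nxt (wsec act nxt ws x @ wsec act nxt ws (\<not> x)) ^^ (k div 2) = id"
proof -
  show e: "even k"
  proof (rule ccontr)
    assume "odd k"
    then obtain j where "k = Suc (2 * j)" by (elim oddE) auto
    then have "(run act nxt ws ^^ k) [x] = [\<not> x]"
      using assms(1) run_pow_active[OF assms(1), where nxt = nxt and j = j and x = x and w = "[]"]
      by (simp add: run_Cons_right)
    then show False using assms(2) by auto
  qed
  show "run act nxt (wsec act nxt ws x @ wsec act nxt ws (\<not> x)) ^^ (k div 2) = id"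
  proof
    fix w
    show "(run act nxt (wsec act nxt ws x @ wsec act nxt ws (\<not> x)) ^^ (k div 2)) w = id w"
      using run_pow_active[OF assms(1), where nxt = nxt and j = "k div 2" and x = x and w = w] assms(2) e by simp
  qed
qed

text \<open>The two words are conjugate by \<open>run act nxt u\<close>; surjectivity of this map
  replaces the use of its inverse.\<close>

lemma rotate_order:
  assumes "run act nxt (u @ v) ^^ k = id"
  shows "run act nxt (v @ u) ^^ k = id"
proof
  fix w
  have 1: "(run act nxt (v @ u) ^^ k) (run act nxt u y) = run act nxt u ((run act nxt (u @ v) ^^ k) y)" for y
    by (induction k) (auto simp: run_append)
  have "\<exists>y. run act nxt u y = w"
  proof (induction u arbitrary: w)
    case (Cons q u)
    then show ?case by (metis run.simps(2) surj_smap)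
  qed auto
  then show "(run act nxt (v @ u) ^^ k) w = id w"
    using 1 assms by auto
qed

text \<open>A worklist search with fuel for a set that contains the worklist \<open>t\<close>, is closed
  under \<open>f\<close> and satisfies \<open>P\<close>. The checkers use \<open>if\<close> rather than
  connectives because the simplifier evaluates only \<open>if\<close> lazily.\<close>

fun closure_ok :: "nat \<Rightarrow> ('s \<Rightarrow> bool) \<Rightarrow> ('s \<Rightarrow> 's list) \<Rightarrow> 's list \<Rightarrow> 's list \<Rightarrow> bool" where
  "closure_ok n P f seen [] = True"
| "closure_ok 0 P f seen (x # t) = False"
| "closure_ok (Suc n) P f seen (x # t) =
    (if List.member seen x then closure_ok n P f seen t
     else if P x then closure_ok n P f (x # seen) (f x @ t) else False)"

text \<open>Loop invariant: everything seen satisfies \<open>P\<close> and has its successors among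
  the seen and waiting elements. Running out of fuel is a failure, so soundness needs no bound on
  the search.\<close>

lemma closure_ok_invariant:
  assumes "closure_ok n P f seen t"
    and "\<And>x. x \<in> set seen \<Longrightarrow> P x \<and> set (f x) \<subseteq> set seen \<union> set t"
  shows "\<exists>X. set seen \<union> set t \<subseteq> X \<and> (\<forall>x\<in>X. P x \<and> set (f x) \<subseteq> X)"
  using assms
proof (induction n P f seen t rule: closure_ok.induct)
  case (1 n P f seen)
  then show ?case by (intro exI[of _ "set seen"]) auto
next
  case (3 n P f seen x t)
  show ?case
  proof (cases "x \<in> set seen")
    case True
    then show ?thesis using 3 by (auto simp: insert_absorb)
  next
    case False
    then have "P x" "closure_ok n P f (x # seen) (f x @ t)"
      using 3(3) by (auto split: if_splits)
    then have "\<exists>X. set (x # seen) \<union> set (f x @ t) \<subseteq> X \<and> (\<forall>x\<in>X. P x \<and> set (f x) \<subseteq> X)"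
      using 3(2)[of] 3(4) False by fastforce
    then show ?thesis by (elim exE) (rule exI, auto)
  qed
qed auto

lemma closure_okD:
  assumes "closure_ok n P f [] t"
  obtains X where "set t \<subseteq> X" "\<And>x. x \<in> X \<Longrightarrow> P x" "\<And>x y. x \<in> X \<Longrightarrow> y \<in> set (f x) \<Longrightarrow> y \<in> X"
  using closure_ok_invariant[OF assms] by auto

text \<open>If all iterated sections are inactive, no letter is ever changed. Sections keep the
  length, so over three states a word of length 2 has at most 9 of them.\<close>

definition trivial_word :: "('q \<Rightarrow> bool) \<Rightarrow> ('q \<Rightarrow> bool \<Rightarrow> 'q) \<Rightarrow> 'q list \<Rightarrow> bool" where
  "trivial_word act nxt ws = closure_ok 30 (\<lambda>u. \<not> wact act u)
     (\<lambda>u. [wsec act nxt u False, wsec act nxt u True]) [] [ws]"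

lemma trivial_wordD:
  assumes "trivial_word act nxt ws"
  shows "run act nxt ws = id"
proof -
  obtain X where X: "ws \<in> X" "\<And>u. u \<in> X \<Longrightarrow> \<not> wact act u"
    "\<And>u x. u \<in> X \<Longrightarrow> wsec act nxt u x \<in> X"
    by (rule closure_okD[OF assms[unfolded trivial_word_def]]) (metis (full_types) list.set_intros subset_iff)
  have "u \<in> X \<Longrightarrow> run act nxt u w = w" for u w
    by (induction w arbitrary: u) (auto simp: run_Cons_right X)
  then show ?thesis using X(1) by auto
qed

section \<open>Executable tests for three states\<close>

datatype state = S0 | S1 | S2

instance state :: finite
proof
  have "(UNIV :: state set) \<subseteq> {S0, S1, S2}"
    using state.exhaust by blast
  then show "finite (UNIV :: state set)" by (rule finite_subset) simp
qed

fun act3 :: "bool \<Rightarrow> state \<Rightarrow> bool" where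
  "act3 e S0 = False" | "act3 e S1 = e" | "act3 e S2 = True"

fun nxt3 :: "state \<Rightarrow> state \<Rightarrow> state \<Rightarrow> state \<Rightarrow> state \<Rightarrow> state \<Rightarrow> state \<Rightarrow> bool \<Rightarrow> state" where
  "nxt3 a b c d e f S0 x = (if x then b else a)"
| "nxt3 a b c d e f S1 x = (if x then d else c)"
| "nxt3 a b c d e f S2 x = (if x then f else e)"

fun some_in :: "('a \<Rightarrow> bool) \<Rightarrow> 'a list \<Rightarrow> bool" where
  "some_in P [] = False"
| "some_in P (x # xs) = (if P x then True else some_in P xs)"

fun all_in :: "('a \<Rightarrow> bool) \<Rightarrow> 'a list \<Rightarrow> bool" where
  "all_in P [] = True"
| "all_in P (x # xs) = (if P x then all_in P xs else False)"

definition uniform :: "('q \<Rightarrow> bool) \<Rightarrow> ('q \<Rightarrow> bool \<Rightarrow> 'q) \<Rightarrow> 'q \<Rightarrow> bool" where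
  "uniform act nxt q = closure_ok 50 (\<lambda>(p, r). act p = act r)
     (\<lambda>(p, r). [(nxt p False, nxt r False), (nxt p False, nxt r True),
        (nxt p True, nxt r False), (nxt p True, nxt r True)]) [] [(q, q)]"

text \<open>Only the sections at the first level are tested; the activities at the root may be
  arbitrary.\<close>

definition uniform_check :: "(state \<Rightarrow> bool) \<Rightarrow> (state \<Rightarrow> bool \<Rightarrow> state) \<Rightarrow> bool" where
  "uniform_check act nxt = all_in (uniform act nxt)
    [nxt S0 False, nxt S0 True, nxt S1 False, nxt S1 True, nxt S2 False, nxt S2 True]"

text \<open>A vector records the parities of the numbers of occurrences of the three states in a word;
  if an active word has the vector \<open>v\<close>, then each first-level section of its square has the
  vector \<open>vec_step nxt v\<close>.\<close>

type_synonym vec = "bool \<times> bool \<times> bool"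

fun toggle :: "state \<Rightarrow> vec \<Rightarrow> vec" where
  "toggle S0 (a, b, c) = (\<not> a, b, c)"
| "toggle S1 (a, b, c) = (a, \<not> b, c)"
| "toggle S2 (a, b, c) = (a, b, \<not> c)"

definition toggle_sections where "toggle_sections nxt q v = toggle (nxt q False) (toggle (nxt q True) v)"

fun vec_act :: "(state \<Rightarrow> bool) \<Rightarrow> vec \<Rightarrow> bool" where
  "vec_act act (a, b, c) = ((a \<and> act S0) \<noteq> ((b \<and> act S1) \<noteq> (c \<and> act S2)))"

fun vec_step :: "(state \<Rightarrow> bool \<Rightarrow> state) \<Rightarrow> vec \<Rightarrow> vec" where
  "vec_step nxt (a, b, c) =
    (if a then toggle_sections nxt S0 else id) ((if b then toggle_sections nxt S1 else id)
      ((if c then toggle_sections nxt S2 else id) (False, False, False)))"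

text \<open>Activity and step depend on the parity vector alone. The fuel 9 covers the 8 vectors and
  a first repetition.\<close>

definition odometer_check :: "(state \<Rightarrow> bool) \<Rightarrow> (state \<Rightarrow> bool \<Rightarrow> state) \<Rightarrow> bool" where
  "odometer_check act nxt = some_in (\<lambda>v. closure_ok 9 (vec_act act) (\<lambda>v. [vec_step nxt v]) [] [v])
     [(a, b, c). a \<leftarrow> [False, True], b \<leftarrow> [False, True], c \<leftarrow> [True, False]]"

text \<open>The letter \<open>(True, q)\<close> denotes the inverse of the state \<open>q\<close>.\<close>

type_synonym letter = "bool \<times> state"

fun lact :: "('q \<Rightarrow> bool) \<Rightarrow> bool \<times> 'q \<Rightarrow> bool" where
  "lact act (i, q) = act q"

text \<open>The inverse of \<open>q\<close> reads what \<open>q\<close> outputs, so it moves to the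
  successor of \<open>q\<close> at the preimage of the letter.\<close>

fun lnxt :: "('q \<Rightarrow> bool) \<Rightarrow> ('q \<Rightarrow> bool \<Rightarrow> 'q) \<Rightarrow> bool \<times> 'q \<Rightarrow> bool \<Rightarrow> bool \<times> 'q" where
  "lnxt act nxt (i, q) x = (i, nxt q (if i then if act q then \<not> x else x else x))"

text \<open>The states \<open>s\<close>, \<open>t\<close> are synchronized by a word of length 1 (resp. 2)
  on which they differ in the last output letter: a difference in the input moves by that length.\<close>

definition sync1 :: "('q \<Rightarrow> bool) \<Rightarrow> ('q \<Rightarrow> bool \<Rightarrow> 'q) \<Rightarrow> 'q \<Rightarrow> 'q \<Rightarrow> bool" where
  "sync1 act nxt s t = (if act s = act t then False else some_in (\<lambda>x. nxt s x = nxt t x) [False, True])"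

definition sync2 :: "('q \<Rightarrow> bool) \<Rightarrow> ('q \<Rightarrow> bool \<Rightarrow> 'q) \<Rightarrow> 'q \<Rightarrow> 'q \<Rightarrow> bool" where
  "sync2 act nxt s t = some_in (\<lambda>x. sync1 act nxt (nxt s x) (nxt t x)) [False, True]"

text \<open>The flag is the parity of the depth: pairs reached along words of equal even length must
  synchronize after reading \<open>False\<close> and \<open>True\<close>, and odd depths are
  exempt.\<close>

definition carries where
  "carries sync nxt z = closure_ok 80
     (\<lambda>(b, p, r). if b then True else sync (nxt p False) (nxt r True))
     (\<lambda>(b, p, r). [(\<not> b, nxt p False, nxt r False), (\<not> b, nxt p False, nxt r True),
        (\<not> b, nxt p True, nxt r False), (\<not> b, nxt p True, nxt r True)]) [] [(False, z, z)]"

definition letters :: "letter list" where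
  "letters = [(False, S0), (False, S1), (False, S2), (True, S0), (True, S1), (True, S2)]"

definition signal_check where
  "signal_check act nxt = some_in (\<lambda>z. if carries (sync1 act nxt) nxt z then True
     else carries (sync2 act nxt) nxt z) letters"

section \<open>Reduction of words up to conjugacy\<close>

fun canon_letter where
  "canon_letter invol (i, q) = (if i then \<not> invol q else False, q)"

fun cancels :: "letter \<Rightarrow> letter \<Rightarrow> (state \<Rightarrow> bool) \<Rightarrow> bool" where
  "cancels (i, p) (j, q) invol = (if p = q then if i = j then invol p else True else False)"

fun push where
  "push triv invol (i, q) ws = (if triv q then ws else
     case ws of [] \<Rightarrow> [canon_letter invol (i, q)]
     | m # ws' \<Rightarrow> if cancels (i, q) m invol then ws' else canon_letter invol (i, q) # ws)"

fun strip :: "nat \<Rightarrow> (state \<Rightarrow> bool) \<Rightarrow> letter list \<Rightarrow> letter list" where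
  "strip 0 invol ws = ws"
| "strip (Suc n) invol [] = []"
| "strip (Suc n) invol [l] = [l]"
| "strip (Suc n) invol (l # m # ws) =
    (if cancels (last (m # ws)) l invol then strip n invol (butlast (m # ws)) else l # m # ws)"

text \<open>Free reduction keeps the map, cyclic reduction only its conjugacy class; this suffices,
  since only orders are compared.\<close>

definition normal_form where
  "normal_form triv invol ws = strip 16 invol (foldr (push triv invol) ws [])"

text \<open>The first list is only a counter; with the word itself it yields all cyclic
  rotations.\<close>

fun rotations where
  "rotations [] u = [u]"
| "rotations (x # f) u = u # rotations f (rotate1 u)"

text \<open>The flag \<open>f\<close> tells whether a square was taken since the start, and \<open>R\<close>
  contains the rotations of the starting word. The bound 6 on the length only prunes the search.\<close>

fun search where
  "search act nxt triv invol 0 R f u = False"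
| "search act nxt triv invol (Suc n) R f u =
    (if u = [] \<or> drop 6 u \<noteq> [] then False
     else if wact act u then
       let v = normal_form triv invol (wsec act nxt u False @ wsec act nxt u True)
       in if List.member R v then True else search act nxt triv invol n R True v
     else some_in (\<lambda>x. let v = normal_form triv invol (wsec act nxt u x)
         in if if f then List.member R v else False then True
            else search act nxt triv invol n R f v) [False, True])"

text \<open>Words, with search depths, found by experiment: together they settle all automata that pass
  none of the other tests.\<close>

definition search_words :: "(nat \<times> letter list) list" where
  "search_words = [(4, [(False, S0), (True, S2)]),
    (2, [(False, S1), (True, S2)]),
    (2, [(False, S1), (True, S0), (False, S1), (True, S2)]),
    (2, [(False, S0), (True, S1), (False, S0), (True, S2)]),
    (2, [(False, S2), (True, S0), (False, S2), (True, S1)]),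
    (6, [(False, S1), (True, S2)]),
    (4, [(False, S1), (False, S2), (True, S0), (True, S2)]),
    (4, [(False, S1), (False, S2), (True, S1), (True, S0)]),
    (4, [(False, S0), (True, S1)]),
    (8, [(False, S0), (True, S1)])]"

text \<open>If all states are involutions and one is trivial, two involutions generate the group and
  torsion makes it finite; otherwise an element of infinite order is sought.\<close>

definition word_check :: "(state \<Rightarrow> bool) \<Rightarrow> (state \<Rightarrow> bool \<Rightarrow> state) \<Rightarrow> bool" where
  "word_check act nxt = (case (trivial_word act nxt [S0], trivial_word act nxt [S1], trivial_word act nxt [S2],
     trivial_word act nxt [S0, S0], trivial_word act nxt [S1, S1], trivial_word act nxt [S2, S2]) of
    (t0, t1, t2, i0, i1, i2) \<Rightarrow>
    if i0 \<and> i1 \<and> i2 \<and> (t0 \<or> t1 \<or> t2) then True else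
     some_in (\<lambda>(n, u). let v = normal_form (case_state t0 t1 t2) (case_state i0 i1 i2) u in
        search (lact act) (lnxt act nxt) (case_state t0 t1 t2) (case_state i0 i1 i2) n
          (rotations v v) False v) search_words)"

definition full_check where
  "full_check act nxt = (if uniform_check act nxt then True else if odometer_check act nxt then True
     else if signal_check (lact act) (lnxt act nxt) then True else word_check act nxt)"

section \<open>Soundness of the tests\<close>

lemma some_in_iff: "some_in P xs \<longleftrightarrow> (\<exists>x\<in>set xs. P x)"
  by (induction xs) auto

lemma all_in_iff: "all_in P xs \<longleftrightarrow> (\<forall>x\<in>set xs. P x)"
  by (induction xs) auto

section \<open>Automata whose activities depend only on the level\<close>

definition level_uniform :: "('q \<Rightarrow> bool) \<Rightarrow> ('q \<Rightarrow> bool \<Rightarrow> 'q) \<Rightarrow> 'q \<Rightarrow> bool" where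
  "level_uniform act nxt q \<longleftrightarrow>
    (\<forall>u v. length u = length v \<longrightarrow> act (reach nxt q u) = act (reach nxt q v))"

lemma uniformD:
  assumes "uniform act nxt q"
  shows "level_uniform act nxt q"
  unfolding level_uniform_def
proof (intro allI impI)
  fix u v :: "bool list" assume len: "length u = length v"
  obtain X where X: "(q, q) \<in> X" "\<And>p r. (p, r) \<in> X \<Longrightarrow> act p = act r"
    "\<And>p r x y. (p, r) \<in> X \<Longrightarrow> (nxt p x, nxt r y) \<in> X"
  proof (rule closure_okD[OF assms(1)[unfolded uniform_def]])
    fix X assume "set [(q, q)] \<subseteq> X" "\<And>x. x \<in> X \<Longrightarrow> case x of (p, r) \<Rightarrow> act p = act r"
      and c: "\<And>x y. x \<in> X \<Longrightarrow> y \<in> set (case x of (p, r) \<Rightarrow> [(nxt p False, nxt r False),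
        (nxt p False, nxt r True), (nxt p True, nxt r False), (nxt p True, nxt r True)]) \<Longrightarrow> y \<in> X"
    moreover have "(p, r) \<in> X \<Longrightarrow> (nxt p x, nxt r y) \<in> X" for p r x y
      using c[of "(p, r)" "(nxt p x, nxt r y)"] by (cases x; cases y) auto
    ultimately show thesis using that[of X] by fastforce
  qed
  have "(p, r) \<in> X \<Longrightarrow> (reach nxt p u, reach nxt r v) \<in> X" for p r
    using len by (induction u v arbitrary: p r rule: list_induct2) (auto intro: X)
  then show "act (reach nxt q u) = act (reach nxt q v)" using X by blast
qed

lemma nth_smap: "i < length w \<Longrightarrow> smap act nxt q w ! i = (w ! i \<noteq> act (reach nxt q (take i w)))"
proof (induction w arbitrary: q i)
  case (Cons x w)
  then show ?case by (cases i) auto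
qed auto

text \<open>Addition modulo 2 of the activity sequences of the states in \<open>S\<close>. For
  level-uniform states every word of length \<open>i\<close> gives the same entry, so a constant
  word is used.\<close>

definition xor_run :: "('q \<Rightarrow> bool) \<Rightarrow> ('q \<Rightarrow> bool \<Rightarrow> 'q) \<Rightarrow> 'q set \<Rightarrow> bool list \<Rightarrow> bool list" where
  "xor_run act nxt S w =
    map (\<lambda>i. w ! i \<noteq> odd (card {p\<in>S. act (reach nxt p (replicate i False))})) [0..<length w]"

text \<open>Level-uniform states act by adding fixed sequences modulo 2. Such maps commute and are
  involutions, so only the states of odd multiplicity matter.\<close>

lemma run_uniform:
  fixes nxt :: "'q::finite \<Rightarrow> bool \<Rightarrow> 'q"
  assumes "\<forall>q\<in>set ws. level_uniform act nxt q"
  shows "\<exists>S. run act nxt ws = xor_run act nxt S"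
  using assms
proof (induction ws)
  case Nil
  show ?case by (rule exI[of _ "{}"]) (auto simp: xor_run_def fun_eq_iff map_nth)
next
  case (Cons q ws)
  then obtain S where S: "run act nxt ws = xor_run act nxt S" by auto
  \<comment> \<open>The symmetric difference of \<open>S\<close> and \<open>{q}\<close>: composing
    with \<open>q\<close> changes the parity of its multiplicity.\<close>
  define T where "T = (if q \<in> S then S - {q} else insert q S)"
  define a where "a p i = act (reach nxt p (replicate i False))" for p i
  have q: "act (reach nxt q (take i w)) = a q i" if "i < length w" for i w
    using Cons.prems that unfolding a_def by (simp add: level_uniform_def)
  have T: "odd (card {p\<in>T. a p i}) \<longleftrightarrow> a q i \<noteq> odd (card {p\<in>S. a p i})" for i
  proof (cases "a q i")
    case True
    show ?thesis
    proof (cases "q \<in> S")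
      case qS: True
      have "{p\<in>S. a p i} = insert q {p\<in>T. a p i}" "q \<notin> {p\<in>T. a p i}"
        using True qS by (auto simp: T_def)
      then have "card {p\<in>S. a p i} = Suc (card {p\<in>T. a p i})"
        by simp
      then show ?thesis using True by simp
    next
      case qS: False
      have "{p\<in>T. a p i} = insert q {p\<in>S. a p i}" "q \<notin> {p\<in>S. a p i}"
        using True qS by (auto simp: T_def)
      then have "card {p\<in>T. a p i} = Suc (card {p\<in>S. a p i})"
        by simp
      then show ?thesis using True by simp
    qed
  next
    case False
    then have "{p\<in>T. a p i} = {p\<in>S. a p i}" by (auto simp: T_def)
    then show ?thesis using False by simp
  qed
  have "run act nxt (q # ws) w = xor_run act nxt T w" for w
    by (rule nth_equalityI)
      (auto simp: S xor_run_def nth_smap q T[unfolded a_def] simp flip: a_def simp: T)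
  then show ?case by blast
qed

lemma set_wsec: "set (wsec act nxt ws x) \<subseteq> {nxt q y | q y. True}"
  by (induction ws arbitrary: x) auto

text \<open>A map is determined by its activity at the root and one set of states for each of its
  two sections.\<close>

lemma finite_of_uniform_sections:
  fixes nxt :: "'q::finite \<Rightarrow> bool \<Rightarrow> 'q"
  assumes "\<And>q x. level_uniform act nxt (nxt q x)"
  shows "finite (range (run act nxt))"
proof -
  define F where "F = (\<lambda>(b, S, T) w. case w of [] \<Rightarrow> [] | x # v \<Rightarrow>
    (x \<noteq> b) # xor_run act nxt (if x then T else S) v)"
  have "run act nxt ws \<in> range F" for ws
  proof -
    have "\<exists>S. run act nxt (wsec act nxt ws x) = xor_run act nxt S" for x
      by (rule run_uniform) (use assms set_wsec[of act nxt ws x] in blast)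
    then obtain S where S: "\<And>x. run act nxt (wsec act nxt ws x) = xor_run act nxt (S x)"
      by metis
    have "run act nxt ws = F (wact act ws, S False, S True)"
    proof
      fix w show "run act nxt ws w = F (wact act ws, S False, S True) w"
        by (cases w) (auto simp: F_def run_Cons_right S)
    qed
    then show ?thesis by blast
  qed
  then show ?thesis by (meson finite finite_imageI finite_subset image_subsetI)
qed

section \<open>Parity vectors and odometers\<close>

lemma toggle_commute: "toggle p (toggle q v) = toggle q (toggle p v)"
  by (cases p; cases q; cases v) auto

lemma toggle_toggle [simp]: "toggle q (toggle q v) = v"
  by (cases q; cases v) auto

definition parity :: "state list \<Rightarrow> vec" where
  "parity ws = foldr toggle ws (False, False, False)"

lemma surj_parity: "\<exists>ws. parity ws = v"
proof -
  obtain a b c where v: "v = (a, b, c)" by (cases v)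
  show ?thesis
    by (rule exI[of _ "(if a then [S0] else []) @ (if b then [S1] else []) @ (if c then [S2] else [])"])
      (auto simp: parity_def v)
qed

lemma wact_parity: "wact act ws = vec_act act (parity ws)"
proof (induction ws)
  case (Cons q ws)
  have "vec_act act (toggle q v) = (vec_act act v \<noteq> act q)" for v
    by (cases q; cases v) auto
  then show ?case using Cons by (auto simp: parity_def)
qed (auto simp: parity_def)

lemma foldr_toggle_Cons: "foldr toggle (A @ q # B) z = toggle q (foldr toggle (A @ B) z)"
  by (induction A) (auto simp: toggle_commute)

lemma vec_step_toggle: "vec_step nxt (toggle q v) = toggle_sections nxt q (vec_step nxt v)"
  by (cases q; cases v)
    (simp_all add: toggle_sections_def, (metis toggle_commute toggle_toggle)+)

text \<open>Along \<open>x\<close> and \<open>\<not> x\<close> each state of the word reads opposite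
  letters, so it contributes both of its successors, whatever precedes it.\<close>

lemma parity_sections: "parity (wsec act nxt ws x @ wsec act nxt ws (\<not> x)) = vec_step nxt (parity ws)"
proof (induction ws arbitrary: x)
  case (Cons q ws)
  have *: "foldr toggle (wsec act nxt ws x @ wsec act nxt ws (\<not> x)) (False, False, False) = vec_step nxt (parity ws)"
    "foldr toggle (wsec act nxt ws (\<not> x) @ wsec act nxt ws x) (False, False, False) = vec_step nxt (parity ws)"
    using Cons[of x] Cons[of "\<not> x"] by (auto simp: parity_def)
  have "toggle (nxt q (\<not> x)) (toggle (nxt q x) v) = toggle_sections nxt q v" for v
    by (cases x) (auto simp: toggle_sections_def toggle_commute)
  moreover have "vec_step nxt (parity (q # ws)) = toggle_sections nxt q (vec_step nxt (parity ws))"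
    by (simp add: vec_step_toggle parity_def)
  ultimately show ?case
    using * by (auto simp: parity_def foldr_toggle_Cons toggle_commute simp del: foldr_append)
qed (auto simp: parity_def)

text \<open>The section of the square is active again at every level, so an exponent killing the
  word is divisible by every power of 2.\<close>

lemma odometer_not_torsion:
  assumes "odometer_check act nxt"
  shows "\<not> torsion_on act nxt"
proof
  assume t: "torsion_on act nxt"
  obtain v where v: "closure_ok 9 (vec_act act) (\<lambda>v. [vec_step nxt v]) [] [v]"
    using assms unfolding odometer_check_def some_in_iff by blast
  obtain X where X: "v \<in> X" "\<And>v. v \<in> X \<Longrightarrow> vec_act act v" "\<And>v. v \<in> X \<Longrightarrow> vec_step nxt v \<in> X"
    by (rule closure_okD[OF v]) auto
  have dvd: "parity ws \<in> X \<Longrightarrow> run act nxt ws ^^ k = id \<Longrightarrow> 2 ^ n dvd k" for ws k n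
  proof (induction n arbitrary: ws k)
    case (Suc n)
    have a: "wact act ws" using Suc.prems X by (simp add: wact_parity)
    have "2 ^ n dvd k div 2"
    proof (rule Suc.IH)
      show "parity (wsec act nxt ws False @ wsec act nxt ws (\<not> False)) \<in> X"
        unfolding parity_sections using X Suc.prems by blast
    qed (rule active_section_order(2)[OF a Suc.prems(2)])
    moreover have "even k" by (rule active_section_order(1)[OF a Suc.prems(2)])
    ultimately show ?case by (auto elim!: evenE)
  qed auto
  obtain ws where "parity ws = v" using surj_parity by blast
  moreover obtain k where "k > 0" "run act nxt ws ^^ k = id"
    using t unfolding torsion_on_def by blast
  \<comment> \<open>Depth \<open>k\<close> is enough, since a positive \<open>k\<close> is smaller
    than \<open>2 ^ k\<close>.\<close>
  ultimately have "2 ^ k dvd k" using dvd X(1) by blast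
  then have "2 ^ k \<le> k" using \<open>k > 0\<close> by (rule dvd_imp_le)
  then show False by (metis less_exp not_less)
qed

section \<open>Propagation of a changed letter\<close>

definition syncs :: "('q \<Rightarrow> bool) \<Rightarrow> ('q \<Rightarrow> bool \<Rightarrow> 'q) \<Rightarrow> nat \<Rightarrow> 'q \<Rightarrow> 'q \<Rightarrow> bool" where
  "syncs act nxt r s t \<longleftrightarrow> (\<exists>e. length e = r \<and> last (smap act nxt s e) \<noteq> last (smap act nxt t e) \<and>
     reach nxt s e = reach nxt t e)"

lemma sync1_syncs: "sync1 act nxt s t \<Longrightarrow> syncs act nxt 1 s t"
  unfolding sync1_def syncs_def some_in_iff
  by (auto split: if_splits intro: exI[of _ "[False]"] exI[of _ "[True]"])

lemma sync2_syncs: "sync2 act nxt s t \<Longrightarrow> syncs act nxt 2 s t"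
  unfolding sync2_def sync1_def syncs_def some_in_iff
  by (auto split: if_splits intro: exI[of _ "[_, _]"])

text \<open>The prefixes \<open>u\<close> and \<open>v\<close> are independent, since letters before
  the changed one may already differ.\<close>

definition carries_at where
  "carries_at act nxt r l z \<longleftrightarrow> (\<forall>u v. length u = l \<longrightarrow> length v = l \<longrightarrow>
    syncs act nxt r (nxt (reach nxt z u) False) (nxt (reach nxt z v) True))"

lemma carriesD:
  assumes c: "carries sync nxt z" and s: "\<And>s t. sync s t \<Longrightarrow> syncs act nxt r s t" and "even l"
  shows "carries_at act nxt r l z"
proof -
  obtain X where X: "(False, z, z) \<in> X" "\<And>p r. (False, p, r) \<in> X \<Longrightarrow> sync (nxt p False) (nxt r True)"
    "\<And>b p r x y. (b, p, r) \<in> X \<Longrightarrow> (\<not> b, nxt p x, nxt r y) \<in> X"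
  proof (rule closure_okD[OF c[unfolded carries_def]])
    fix X assume "set [(False, z, z)] \<subseteq> X"
      "\<And>x. x \<in> X \<Longrightarrow> case x of (b, p, r) \<Rightarrow> if b then True else sync (nxt p False) (nxt r True)"
      and c: "\<And>x y. x \<in> X \<Longrightarrow> y \<in> set (case x of (b, p, r) \<Rightarrow>
        [(\<not> b, nxt p False, nxt r False), (\<not> b, nxt p False, nxt r True),
         (\<not> b, nxt p True, nxt r False), (\<not> b, nxt p True, nxt r True)]) \<Longrightarrow> y \<in> X"
    moreover have "(b, p, r) \<in> X \<Longrightarrow> (\<not> b, nxt p x, nxt r y) \<in> X" for b p r x y
      using c[of "(b, p, r)" "(\<not> b, nxt p x, nxt r y)"] by (cases x; cases y) auto
    ultimately show thesis using that[of X] by fastforce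
  qed
  have reachable: "length u = length v \<Longrightarrow> (b, p, r) \<in> X \<Longrightarrow>
    (b \<noteq> odd (length u), reach nxt p u, reach nxt r v) \<in> X" for b p r u v
  proof (induction u v arbitrary: b p r rule: list_induct2)
    case (Cons x u y v)
    then show ?case using X(3)[of b p r x y] Cons.IH[of "\<not> b"] by (cases b) auto
  qed auto
  have "(False, reach nxt z u, reach nxt z v) \<in> X" if "length u = l" "length v = l" for u v
    using that reachable[of u v False z z] X(1) \<open>even l\<close> by simp
  then show ?thesis
    unfolding carries_at_def by (intro allI impI s X(2)) auto
qed

text \<open>Each state meets the difference \<open>r\<close> positions further to the right than the
  state before it.\<close>

fun layers where
  "layers act nxt r l [] = True"
| "layers act nxt r l (q # qs) = (carries_at act nxt r l q \<and> layers act nxt r (l + r) qs)"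

lemma layers_append:
  "layers act nxt r l (u @ v) = (layers act nxt r l u \<and> layers act nxt r (l + r * length u) v)"
  by (induction u arbitrary: l) (auto simp: algebra_simps)

lemma syncs_sym: "syncs act nxt r s t \<Longrightarrow> syncs act nxt r t s"
  unfolding syncs_def by metis

text \<open>While reading the synchronizing word, the two runs of the first state merge and leave a
  difference in its last output letter, which is the changed letter for the remaining
  states.\<close>

lemma signal_propagates:
  assumes "r > 0" "layers act nxt r l qs" "length u = l" "length v = l" "x \<noteq> y"
  shows "\<exists>e. (e \<noteq> [] \<or> qs = []) \<and> last (run act nxt qs (u @ x # e)) \<noteq> last (run act nxt qs (v @ y # e))"
  using assms(2-)
proof (induction qs arbitrary: l u v x y)
  case Nil
  then show ?case by (auto intro: exI[of _ "[]"])
next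
  case (Cons q qs)
  define s where "s = nxt (reach nxt q u) x"
  define t where "t = nxt (reach nxt q v) y"
  have "syncs act nxt r s t"
    using Cons.prems unfolding s_def t_def
    by (cases x; cases y) (auto simp: carries_at_def intro: syncs_sym)
  then obtain e where e: "length e = r" "last (smap act nxt s e) \<noteq> last (smap act nxt t e)"
    "reach nxt s e = reach nxt t e"
    unfolding syncs_def by blast
  define u' where "u' = smap act nxt q (u @ x # butlast e)"
  define v' where "v' = smap act nxt q (v @ y # butlast e)"
  define p where "p = reach nxt s e"
  have ne: "smap act nxt s' e = butlast (smap act nxt s' e) @ [last (smap act nxt s' e)]" for s'
    using e(1) \<open>r > 0\<close> by (metis append_butlast_last_id length_0_conv length_smap less_irrefl)
  have bl: "butlast (smap act nxt s' e) = smap act nxt s' (butlast e)" for s'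
    using e(1) \<open>r > 0\<close> smap_append[of act nxt s' "butlast e" "[last e]"]
    by (cases e rule: rev_cases) auto
  have U: "smap act nxt q (u @ x # e @ w) = u' @ last (smap act nxt s e) # smap act nxt p w" for w
    using ne[of s] unfolding u'_def s_def p_def bl by (simp add: smap_append)
  have V: "smap act nxt q (v @ y # e @ w) = v' @ last (smap act nxt t e) # smap act nxt p w" for w
    using ne[of t] unfolding v'_def t_def p_def bl e(3)[unfolded s_def t_def] s_def by (simp add: smap_append)
  have len: "length u' = l + r" "length v' = l + r"
    using Cons.prems e(1) \<open>r > 0\<close> by (auto simp: u'_def v'_def)
  obtain e' where e': "last (run act nxt qs (u' @ last (smap act nxt s e) # e')) \<noteq>
      last (run act nxt qs (v' @ last (smap act nxt t e) # e'))"
    using Cons.IH[OF _ len e(2)] Cons.prems by auto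
  \<comment> \<open>Both runs have reached \<open>p\<close>, so one preimage under \<open>p\<close>
    supplies both inputs with the suffix that the remaining states require.\<close>
  obtain w where w: "smap act nxt p w = e'" using surj_smap by metis
  show ?case
    by (rule exI[of _ "e @ w"]) (use U[of w] V[of w] w e' e(1) \<open>r > 0\<close> in auto)
qed

lemma layers_replicate:
  assumes "\<And>l. even l \<Longrightarrow> layers act nxt r l ws" "even (length ws)" "even l"
  shows "layers act nxt r l (concat (replicate k ws))"
  using assms(3)
  by (induction k arbitrary: l) (auto simp: layers_append assms(1,2))

text \<open>If a power were trivial, the outputs would equal the inputs, which share the last letter
  of the nonempty word \<open>e\<close>.\<close>

lemma layers_not_torsion:
  assumes "\<And>l. even l \<Longrightarrow> layers act nxt r l ws" "r > 0" "even (length ws)" "ws \<noteq> []"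
  shows "\<not> torsion_on act nxt"
proof
  assume "torsion_on act nxt"
  then obtain k where k: "k > 0" "run act nxt ws ^^ k = id" unfolding torsion_on_def by blast
  let ?qs = "concat (replicate k ws)"
  have "?qs \<noteq> []" using k assms(4) by (cases k) auto
  moreover have "layers act nxt r 0 ?qs" by (rule layers_replicate) (use assms in auto)
  ultimately obtain e where "e \<noteq> []" "last (run act nxt ?qs ([] @ False # e)) \<noteq> last (run act nxt ?qs ([] @ True # e))"
    using signal_propagates[of r act nxt 0 ?qs "[]" "[]" False True] \<open>r > 0\<close> by auto
  then show False by (simp add: run_concat_replicate k(2))
qed

lemma signal_not_torsion:
  assumes "signal_check act nxt"
  shows "\<not> torsion_on act nxt"
proof -
  obtain z where "carries (sync1 act nxt) nxt z \<or> carries (sync2 act nxt) nxt z"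
    using assms by (auto simp: signal_check_def some_in_iff split: if_splits)
  then show ?thesis
  proof
    assume c: "carries (sync1 act nxt) nxt z"
    have 1: "carries_at act nxt 1 l z" if "even l" for l
      by (rule carriesD[OF c sync1_syncs that])
    \<comment> \<open>With steps of length 1 the second state meets the difference at odd positions;
      starting from a successor of \<open>z\<close> makes the depth below \<open>z\<close> even
      again.\<close>
    have 2: "carries_at act nxt 1 (Suc l) (nxt z False)" if "even l" for l
    proof -
      have "carries_at act nxt 1 (Suc (Suc l)) z" using 1 that by simp
      then show ?thesis unfolding carries_at_def
        by (metis foldl_Cons length_Cons)
    qed
    show ?thesis
      by (rule layers_not_torsion[of act nxt 1 "[z, nxt z False]"]) (use 1 2 in auto)
  next
    assume c: "carries (sync2 act nxt) nxt z"
    have "carries_at act nxt 2 l z" if "even l" for l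
      by (rule carriesD[OF c sync2_syncs that])
    \<comment> \<open>With steps of length 2 all positions stay even; \<open>z\<close> is doubled to
      get a word of even length.\<close>
    then show ?thesis
      by (intro layers_not_torsion[of act nxt 2 "[z, z]"]) auto
  qed
qed

section \<open>Inverse letters and descent of orders\<close>

lemma smap_letter [simp]: "smap (lact act) (lnxt act nxt) (False, q) w = smap act nxt q w"
  by (induction w arbitrary: q) auto

lemma smap_inverse_left [simp]: "smap (lact act) (lnxt act nxt) (True, q) (smap act nxt q w) = w"
proof (induction w arbitrary: q)
  case (Cons x w)
  have "(if act q then \<not> (x \<noteq> act q) else (x \<noteq> act q)) = x" by auto
  then show ?case using Cons by auto
qed auto

lemma smap_inverse_right [simp]: "smap act nxt q (smap (lact act) (lnxt act nxt) (True, q) w) = w"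
  by (metis smap_inverse_left surj_smap)

context
  fixes act :: "state \<Rightarrow> bool" and nxt and triv invol :: "state \<Rightarrow> bool"
  assumes triv: "\<And>q w. triv q \<Longrightarrow> smap act nxt q w = w"
    and invol: "\<And>q w. invol q \<Longrightarrow> smap act nxt q (smap act nxt q w) = w"
begin

abbreviation "lsmap \<equiv> smap (lact act) (lnxt act nxt)"
abbreviation "lrun \<equiv> run (lact act) (lnxt act nxt)"

lemma inverse_of_involution: "invol q \<Longrightarrow> lsmap (True, q) w = smap act nxt q w"
  by (metis invol smap_inverse_left)

lemma inverse_of_trivial: "triv q \<Longrightarrow> lsmap (True, q) w = w"
  by (metis triv smap_inverse_left)

lemma lsmap_canon_letter: "lsmap (canon_letter invol l) w = lsmap l w"
  by (cases l; cases "invol (snd l)"; cases "fst l") (auto simp: inverse_of_involution)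

lemma lsmap_cancels: "cancels l m invol \<Longrightarrow> lsmap m (lsmap l w) = w"
  by (cases l; cases m; cases "fst l"; cases "fst m")
    (auto simp: inverse_of_involution invol split: if_splits)

lemma lrun_push: "lrun (push triv invol l ws) w = lrun (l # ws) w"
proof (cases l)
  case (Pair i q)
  have "lsmap (i, q) w = w" if "triv q"
    using triv[OF that] inverse_of_trivial[OF that] by (cases i) auto
  then show ?thesis
    by (cases ws) (auto simp: Pair lsmap_canon_letter lsmap_cancels simp del: canon_letter.simps cancels.simps)
qed

lemma lrun_reduce: "lrun (foldr (push triv invol) ws []) w = lrun ws w"
  by (induction ws arbitrary: w) (auto simp: lrun_push)

text \<open>Letters that cancel across the two ends become adjacent by a rotation, which is a
  conjugation.\<close>

lemma strip_order:
  assumes "lrun ws ^^ k = id"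
  shows "lrun (strip n invol ws) ^^ k = id"
  using assms
proof (induction n arbitrary: ws)
  case (Suc n)
  show ?case
  proof (cases "\<exists>l m ws'. ws = l # m # ws' \<and> cancels (last (m # ws')) l invol")
    case True
    then obtain l m ws' where ws: "ws = l # m # ws'" and c: "cancels (last (m # ws')) l invol" by blast
    define mid where "mid = butlast (m # ws')"
    define x where "x = last (m # ws')"
    have "[l] @ mid @ [x] = ws"
      unfolding mid_def x_def ws by simp
    then have "lrun ([l] @ (mid @ [x])) ^^ k = id"
      using Suc.prems by metis
    then have "lrun ((mid @ [x]) @ [l]) ^^ k = id"
      by (rule rotate_order)
    moreover have "lrun ((mid @ [x]) @ [l]) = lrun mid"
      using lsmap_cancels[OF c] by (simp add: fun_eq_iff run_append x_def)
    moreover have "strip (Suc n) invol ws = strip n invol mid"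
      using c by (simp add: ws mid_def)
    ultimately show ?thesis using Suc.IH by metis
  next
    case False
    then have "strip (Suc n) invol ws = ws"
      by (cases "(n, invol, ws)" rule: strip.cases; cases ws; cases "tl ws") auto
    then show ?thesis using Suc.prems by metis
  qed
qed auto

lemma normal_form_order:
  assumes "lrun ws ^^ k = id"
  shows "lrun (normal_form triv invol ws) ^^ k = id"
proof -
  have "lrun (foldr (push triv invol) ws []) = lrun ws" by (rule ext) (rule lrun_reduce)
  then show ?thesis unfolding normal_form_def by (metis assms strip_order)
qed

lemma rotations_order:
  assumes "v \<in> set (rotations f u)" "lrun v ^^ k = id"
  shows "lrun u ^^ k = id"
  using assms(1)
proof (induction f arbitrary: u)
  case (Cons x f)
  show ?case
  proof (cases "v = u")
    case False
    then have r: "lrun (rotate1 u) ^^ k = id" using Cons by auto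
    show ?thesis
    proof (cases u)
      case (Cons q u')
      then have "lrun (u' @ [q]) ^^ k = id" using r by (metis rotate1.simps(2))
      then have "lrun ([q] @ u') ^^ k = id" by (rule rotate_order)
      then show ?thesis unfolding Cons by (metis append_Cons append_Nil)
    qed (use r in \<open>metis rotate1.simps(1)\<close>)
  qed (use assms in metis)
qed (use assms(2) in \<open>auto dest: singletonD\<close>)

text \<open>Sections of inactive words and rotations keep an exponent, squares of active words halve
  it. If \<open>f\<close> holds, a halving took place before \<open>v\<close>, so the weak
  inequality is enough.\<close>

lemma search_order:
  assumes "search (lact act) (lnxt act nxt) triv invol n (rotations w u) f v" "lrun v ^^ k = id" "k > 0"
  shows "\<exists>j>0. lrun u ^^ j = id \<and> j \<le> k \<and> (f \<or> j < k)"
  using assms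
proof (induction n arbitrary: f v k)
  case (Suc n)
  show ?case
  proof (cases "wact (lact act) v")
    case True
    let ?v = "normal_form triv invol (wsec (lact act) (lnxt act nxt) v False @ wsec (lact act) (lnxt act nxt) v (\<not> False))"
    have k: "even k" "lrun ?v ^^ (k div 2) = id"
      using active_section_order[OF True Suc.prems(2)] normal_form_order by blast+
    then have less: "0 < k div 2" "k div 2 < k" using Suc.prems(3) by (auto elim: evenE)
    show ?thesis
    proof (cases "?v \<in> set (rotations w u)")
      case True
      then have "lrun u ^^ (k div 2) = id" using rotations_order k(2) by blast
      then show ?thesis using less by (intro exI[of _ "k div 2"]) auto
    next
      case False
      then have "search (lact act) (lnxt act nxt) triv invol n (rotations w u) True ?v"
        using Suc.prems(1) True by (auto simp: Let_def split: if_splits)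
      then show ?thesis using Suc.IH[OF _ k(2) less(1)] less(2) by fastforce
    qed
  next
    case False
    then obtain x where x: "(f \<and> normal_form triv invol (wsec (lact act) (lnxt act nxt) v x) \<in> set (rotations w u)) \<or>
        search (lact act) (lnxt act nxt) triv invol n (rotations w u) f (normal_form triv invol (wsec (lact act) (lnxt act nxt) v x))"
      using Suc.prems(1) by (auto simp: Let_def some_in_iff split: if_splits)
    have "lrun (normal_form triv invol (wsec (lact act) (lnxt act nxt) v x)) ^^ k = id"
      using inactive_section_order[OF False Suc.prems(2)] normal_form_order by blast
    then show ?thesis using x Suc.IH Suc.prems(3) rotations_order by blast
  qed
qed auto

text \<open>The least positive exponent killing \<open>u\<close> would yield a smaller one.\<close>

lemma search_not_torsion:
  assumes "search (lact act) (lnxt act nxt) triv invol n (rotations w u) False u"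
  shows "\<not> torsion_on (lact act) (lnxt act nxt)"
proof
  assume "torsion_on (lact act) (lnxt act nxt)"
  then have ex: "\<exists>k. k > 0 \<and> lrun u ^^ k = id" unfolding torsion_on_def by blast
  define k where "k = (LEAST k. k > 0 \<and> lrun u ^^ k = id)"
  have "k > 0 \<and> lrun u ^^ k = id" unfolding k_def by (rule LeastI_ex[OF ex])
  then obtain j where "j > 0" "lrun u ^^ j = id" "j < k"
    using search_order[OF assms, of k] by auto
  then show False using not_less_Least[of j "\<lambda>k. k > 0 \<and> lrun u ^^ k = id"] unfolding k_def by blast
qed

end

text \<open>The inverse of a state of finite order is one of its powers, so inverse letters give no
  new maps.\<close>

lemma torsion_on_letters:
  assumes t: "torsion_on act nxt"
  shows "torsion_on (lact act) (lnxt act nxt)"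
proof -
  let ?run = "run (lact act) (lnxt act nxt)"
  have 1: "\<exists>us. run act nxt us = smap (lact act) (lnxt act nxt) l" for l
  proof (cases l)
    case (Pair i q)
    show ?thesis
    proof (cases i)
      case True
      obtain k where k: "k > 0" "run act nxt [q] ^^ k = id" using t unfolding torsion_on_def by blast
      let ?us = "concat (replicate (k - 1) [q])"
      have "run act nxt ?us w = smap (lact act) (lnxt act nxt) (True, q) w" for w
      proof -
        have "run act nxt [q] (run act nxt ?us w) = (run act nxt [q] ^^ k) w"
          unfolding run_concat_replicate using k(1) by (cases k) auto
        then have "smap act nxt q (run act nxt ?us w) = w" using k(2) by simp
        then show ?thesis by (metis smap_inverse_left)
      qed
      then have "run act nxt ?us = smap (lact act) (lnxt act nxt) l" by (simp add: fun_eq_iff Pair True)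
      then show ?thesis by blast
    qed (auto simp: Pair intro!: exI[of _ "[q]"])
  qed
  have "\<exists>us. run act nxt us = ?run ws" for ws
  proof (induction ws)
    case Nil
    then show ?case by (intro exI[of _ "[]"]) (auto simp: fun_eq_iff)
  next
    case (Cons l ws)
    then obtain us vs where "run act nxt us = ?run ws" "run act nxt vs = smap (lact act) (lnxt act nxt) l"
      using 1 by metis
    then show ?case by (intro exI[of _ "vs @ us"]) (auto simp: fun_eq_iff run_append)
  qed
  then show ?thesis using t unfolding torsion_on_def by metis
qed

section \<open>Groups generated by two involutions\<close>

lemma finite_dihedral:
  fixes P Q :: "'a \<Rightarrow> 'a"
  assumes P: "P \<circ> P = id" and Q: "Q \<circ> Q = id" and N: "(P \<circ> Q) ^^ N = id" "N > 0"
    and smap: "\<And>q. smap' q \<in> {id, P, Q}"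
  shows "finite {foldr (\<lambda>q f. f \<circ> smap' q) ws id | ws. True}"
proof -
  define g where "g = P \<circ> Q"
  \<comment> \<open>The rotations \<open>g ^^ i\<close> and the reflections
    \<open>g ^^ i \<circ> P\<close>; the finite order of \<open>g\<close> leaves finitely
    many.\<close>
  define X where "X = {g ^^ i \<circ> E | i E. E \<in> {id, P}}"
  have mod: "g ^^ i = g ^^ (i mod N)" for i
  proof -
    have "g ^^ i = g ^^ (i mod N + N * (i div N))" by simp
    also have "\<dots> = g ^^ (i mod N) \<circ> (g ^^ N) ^^ (i div N)"
      by (simp only: funpow_add funpow_mult)
    finally show ?thesis using N by (simp add: g_def)
  qed
  have "X \<subseteq> (\<lambda>(i, E). g ^^ i \<circ> E) ` ({..<N} \<times> {id, P})"
  proof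
    fix h assume "h \<in> X"
    then obtain i E where h: "h = g ^^ i \<circ> E" "E \<in> {id, P}" by (auto simp: X_def)
    then have "h = g ^^ (i mod N) \<circ> E" using mod by metis
    then show "h \<in> (\<lambda>(i, E). g ^^ i \<circ> E) ` ({..<N} \<times> {id, P})"
      using h(2) N(2) by (intro image_eqI[of _ _ "(i mod N, E)"]) auto
  qed
  then have "finite X" by (rule finite_subset) auto
  \<comment> \<open>The dihedral relation, that conjugation by \<open>P\<close> inverts
    \<open>g\<close>, written without inverses.\<close>
  have gP: "g \<circ> P \<circ> g = P" using P Q by (auto simp: g_def fun_eq_iff)
  have step: "f \<circ> E \<in> X" if fX: "f \<in> X" and E: "E \<in> {id, P, Q}" for f E
  proof -
    obtain i E' where f: "f = g ^^ i \<circ> E'" "E' \<in> {id, P}" using fX unfolding X_def by blast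
    \<comment> \<open>Since \<open>Q\<close> is the inverse of \<open>g\<close> composed with
      \<open>P\<close>, the exponent drops by one; adding \<open>N\<close> keeps it natural.\<close>
    have 1: "g ^^ i \<circ> Q = g ^^ (i + N - 1) \<circ> P"
    proof -
      have "g ^^ (i + N - 1) \<circ> P = g ^^ (i + (N - 1)) \<circ> (g \<circ> P \<circ> g)"
        using N(2) gP by simp
      also have "\<dots> = g ^^ i \<circ> (g ^^ (N - 1) \<circ> g) \<circ> P \<circ> g" by (auto simp: funpow_add)
      also have "g ^^ (N - 1) \<circ> g = id" using N by (cases N) (auto simp: g_def funpow_swap1 fun_eq_iff)
      also have "g ^^ i \<circ> id \<circ> P \<circ> g = g ^^ i \<circ> Q" using P by (auto simp: g_def fun_eq_iff)
      finally show ?thesis by (rule sym)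
    qed
    have 2: "g ^^ i \<circ> P \<circ> Q = g ^^ Suc i" by (auto simp: g_def funpow_swap1 fun_eq_iff)
    have 3: "g ^^ i \<circ> P \<circ> P = g ^^ i \<circ> id" using P by (auto simp: fun_eq_iff)
    have X: "g ^^ j \<in> X" "g ^^ j \<circ> P \<in> X" for j unfolding X_def by force+
    show ?thesis using f E X X[of "Suc i"] 1 2 3 by auto
  qed
  have "foldr (\<lambda>q f. f \<circ> smap' q) ws id \<in> X" for ws
  proof (induction ws)
    case Nil
    have "foldr (\<lambda>q f. f \<circ> smap' q) [] id = g ^^ 0 \<circ> id" by simp
    then show ?case unfolding X_def by blast
  next
    case (Cons q ws)
    have "foldr (\<lambda>q f. f \<circ> smap' q) (q # ws) id = foldr (\<lambda>q f. f \<circ> smap' q) ws id \<circ> smap' q"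
      by simp
    then show ?case using step[OF Cons smap[of q]] by metis
  qed
  then show ?thesis using \<open>finite X\<close> by (auto intro: finite_subset)
qed

lemma run_foldr: "run act nxt ws = foldr (\<lambda>q f. f \<circ> smap act nxt q) ws id"
  by (induction ws) (auto simp: fun_eq_iff)

lemma finite_of_involutions:
  assumes t: "torsion_on act nxt" and i: "\<And>q. trivial_word act nxt [q, q]"
    and s: "trivial_word act nxt [s]" "\<And>q. q \<in> {p, r, s}"
  shows "finite (range (run act nxt))"
proof -
  let ?f = "smap act nxt"
  have inv: "?f q \<circ> ?f q = id" for q
    using trivial_wordD[OF i[of q]] by (auto simp: fun_eq_iff)
  obtain N where N: "N > 0" "run act nxt [r, p] ^^ N = id"
    using t unfolding torsion_on_def by blast
  have "run act nxt [r, p] = ?f p \<circ> ?f r" by auto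
  then have g: "(?f p \<circ> ?f r) ^^ N = id" using N(2) by metis
  have "?f s = id" using trivial_wordD[OF s(1)] by (auto simp: fun_eq_iff)
  then have "?f q \<in> {id, ?f p, ?f r}" for q using s(2)[of q] by auto
  then have "finite {foldr (\<lambda>q f. f \<circ> ?f q) ws id | ws. True}"
    using finite_dihedral[OF inv inv g N(1)] by blast
  then show ?thesis unfolding run_foldr by (simp add: full_SetCompr_eq)
qed

lemma word_check_finite:
  assumes c: "word_check act nxt" and t: "torsion_on act nxt"
  shows "finite (range (run act nxt))"
proof -
  define triv where "triv = case_state (trivial_word act nxt [S0]) (trivial_word act nxt [S1]) (trivial_word act nxt [S2])"
  define invol where "invol = case_state (trivial_word act nxt [S0, S0]) (trivial_word act nxt [S1, S1]) (trivial_word act nxt [S2, S2])"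
  have triv: "triv q = trivial_word act nxt [q]" and invol: "invol q = trivial_word act nxt [q, q]" for q
    by (cases q; simp add: triv_def invol_def)+
  consider "invol S0" "invol S1" "invol S2" "triv S0 \<or> triv S1 \<or> triv S2"
    | n u where "search (lact act) (lnxt act nxt) triv invol n (rotations (normal_form triv invol u) (normal_form triv invol u)) False (normal_form triv invol u)"
    using c unfolding word_check_def some_in_iff triv_def invol_def Let_def by (auto split: if_splits)
  then show ?thesis
  proof cases
    case 1
    then have i: "trivial_word act nxt [q, q]" for q using invol by (cases q) auto
    \<comment> \<open>In each of the three cases the trivial state comes last, after the two
      involutions.\<close>
    have "q \<in> {S0, S1, S2}" "q \<in> {S0, S2, S1}" "q \<in> {S1, S2, S0}" for q by (cases q; simp)+
    then show ?thesis using 1 triv finite_of_involutions[OF t i] by metis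
  next
    case 2
    have "\<not> torsion_on (lact act) (lnxt act nxt)"
      by (rule search_not_torsion[OF _ _ 2])
        (auto dest!: trivial_wordD simp: triv invol fun_eq_iff)
    then show ?thesis using torsion_on_letters[OF t] by blast
  qed
qed

section \<open>Torsion implies finiteness for three-state automata\<close>

lemma full_check_finite:
  assumes d: "full_check act nxt" and t: "torsion_on act nxt"
  shows "finite (range (run act nxt))"
proof -
  consider "uniform_check act nxt" | "odometer_check act nxt" | "signal_check (lact act) (lnxt act nxt)"
    | "word_check act nxt"
    using d unfolding full_check_def by (auto split: if_splits)
  then show ?thesis
  proof cases
    case 1
    have "level_uniform act nxt (nxt q x)" for q x
      by (rule uniformD) (use 1 in \<open>cases q; cases x; simp add: uniform_check_def all_in_iff\<close>)
    then show ?thesis by (rule finite_of_uniform_sections)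
  next
    case 2
    then show ?thesis using odometer_not_torsion t by blast
  next
    case 3
    then show ?thesis using signal_not_torsion torsion_on_letters[OF t] by blast
  next
    case 4
    then show ?thesis using t by (rule word_check_finite)
  qed
qed

abbreviation all_states :: "(state \<Rightarrow> bool) \<Rightarrow> bool" where
  "all_states P \<equiv> all_in P [S0, S1, S2]"

text \<open>Evaluation over the six successors, which give \<open>3 ^ 6 = 729\<close> automata with
  activity pattern (0,0,1).\<close>

lemma full_check_one_active:
  "all_states (\<lambda>a. all_states (\<lambda>b. all_states (\<lambda>c. all_states (\<lambda>d. all_states (\<lambda>e. all_states (\<lambda>f.
    full_check (act3 False) (nxt3 a b c d e f)))))))"
  by code_simp

lemma full_check_two_active:
  "all_states (\<lambda>a. all_states (\<lambda>b. all_states (\<lambda>c. all_states (\<lambda>d. all_states (\<lambda>e. all_states (\<lambda>f.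
    full_check (act3 True) (nxt3 a b c d e f)))))))"
  by code_simp

lemma all_statesD: "all_states P \<Longrightarrow> P s"
  by (cases s) (auto split: if_splits)

lemma torsion_imp_finite:
  fixes act :: "state \<Rightarrow> bool"
  assumes t: "torsion_on act nxt" and sorted: "act S0 \<longrightarrow> act S1" "act S1 \<longrightarrow> act S2"
  shows "finite (range (run act nxt))"
proof (cases "act S0 = act S2")
  case True
  then have "act p = act q" for p q using sorted by (cases p; cases q) auto
  then have "level_uniform act nxt q" for q unfolding level_uniform_def by blast
  then show ?thesis by (rule finite_of_uniform_sections)
next
  case False
  have act: "act = act3 (act S1)"
  proof
    fix s show "act s = act3 (act S1) s" using False sorted by (cases s) auto
  qed
  have nxt: "nxt = nxt3 (nxt S0 False) (nxt S0 True) (nxt S1 False) (nxt S1 True) (nxt S2 False) (nxt S2 True)"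
  proof (intro ext)
    fix s x show "nxt s x = nxt3 (nxt S0 False) (nxt S0 True) (nxt S1 False) (nxt S1 True)
      (nxt S2 False) (nxt S2 True) s x"
      by (cases s; cases x) auto
  qed
  have "full_check (act3 b) (nxt3 p0 p1 p2 p3 p4 p5)" for b p0 p1 p2 p3 p4 p5
    using all_statesD[OF all_statesD[OF all_statesD[OF all_statesD[OF all_statesD[OF all_statesD[OF
        full_check_one_active]]]]]]
      all_statesD[OF all_statesD[OF all_statesD[OF all_statesD[OF all_statesD[OF all_statesD[OF
        full_check_two_active]]]]]]
    by (cases b) simp_all
  then have "full_check act nxt" by (subst act, subst nxt)
  then show ?thesis using t by (rule full_check_finite)
qed

section \<open>Transfer to automaton groups\<close>

definition state_run :: "('q, 'x) automaton \<Rightarrow> 'q list \<Rightarrow> 'x list \<Rightarrow> 'x list" where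
  "state_run A qs = foldr (\<lambda>q f. f \<circ> state_map A q) qs id"

lemma state_run_append: "state_run A (u @ v) = state_run A v \<circ> state_run A u"
  by (induction u) (auto simp: state_run_def comp_assoc)

lemma state_run_replicate: "state_run A (replicate n q) = state_map A q ^^ n"
  by (induction n) (auto simp: state_run_def fun_eq_iff funpow_swap1)

lemma state_run_in_generate: "state_run A qs \<in> generate tree_Aut (range (state_map A))"
proof (induction qs)
  case Nil
  have "state_run A [] = \<one>\<^bsub>tree_Aut\<^esub>" by (simp add: state_run_def tree_Aut_def)
  then show ?case by (metis generate.one)
next
  case (Cons q qs)
  have "state_map A q \<in> generate tree_Aut (range (state_map A))" by (rule generate.incl) simp
  moreover have "state_run A (q # qs) = state_run A qs \<otimes>\<^bsub>tree_Aut\<^esub> state_map A q"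
    by (simp add: state_run_def tree_Aut_def)
  ultimately show ?case using generate.eng Cons by metis
qed

lemma automaton_group_pow: "f [^]\<^bsub>automaton_group A\<^esub> (n::nat) = f ^^ n"
proof (induction n)
  case (Suc n)
  then show ?case
    unfolding nat_pow_Suc by (simp add: automaton_group_def tree_Aut_def funpow_Suc_right del: funpow.simps)
qed (simp add: automaton_group_def tree_Aut_def)

lemma torsion_state_run:
  assumes "torsion_group (automaton_group A)"
  shows "\<exists>n>0. state_run A qs ^^ n = id"
proof -
  have "state_run A qs \<in> carrier (automaton_group A)"
    using state_run_in_generate[of A qs] by (simp add: automaton_group_def)
  then obtain n :: nat where "n > 0" "state_run A qs [^]\<^bsub>automaton_group A\<^esub> n = \<one>\<^bsub>automaton_group A\<^esub>"
    using assms unfolding torsion_group_def by blast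
  then show ?thesis
    unfolding automaton_group_pow by (auto simp: automaton_group_def tree_Aut_def)
qed

text \<open>Every generator has a power of itself as its inverse, so products of generators already
  form the whole group.\<close>

lemma carrier_automaton_group_torsion:
  assumes A: "invertible_automaton A" and t: "torsion_group (automaton_group A)"
  shows "carrier (automaton_group A) \<subseteq> range (state_run A)"
proof
  fix g assume "g \<in> carrier (automaton_group A)"
  then have "g \<in> generate tree_Aut (range (state_map A))" by (simp add: automaton_group_def)
  then show "g \<in> range (state_run A)"
  proof (induction g rule: generate.induct)
    case one
    show ?case by (rule range_eqI[of _ _ "[]"]) (simp add: state_run_def tree_Aut_def)
  next
    case (incl h)
    then obtain q where "h = state_map A q" by blast
    then show ?case by (intro range_eqI[of _ _ "[q]"]) (simp add: state_run_def)
  next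
    case (inv h)
    then obtain q where h: "h = state_map A q" by blast
    obtain n where n: "n > 0" "state_map A q ^^ n = id"
      using torsion_state_run[OF t, of "[q]"] by (auto simp: state_run_def)
    let ?g = "state_run A (replicate (n - 1) q)"
    have "range (state_map A) \<subseteq> carrier tree_Aut" using state_map_in_tree_Aut[OF A] by blast
    then have "?g \<in> carrier tree_Aut"
      by (rule group.generate_in_carrier[OF group_tree_Aut _ state_run_in_generate])
    moreover have "?g \<circ> h = id"
      using n by (cases n) (auto simp: h state_run_replicate funpow_Suc_right simp del: funpow.simps)
    ultimately have "inv\<^bsub>tree_Aut\<^esub> h = ?g"
      by (intro group.inv_equality[OF group_tree_Aut])
        (auto simp: h state_map_in_tree_Aut[OF A], simp add: tree_Aut_def)
    then show ?case by blast
  next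
    case (eng g h)
    then obtain u v where "g = state_run A u" "h = state_run A v" by blast
    then have "g \<otimes>\<^bsub>tree_Aut\<^esub> h = state_run A (v @ u)"
      by (simp add: state_run_append tree_Aut_def)
    then show ?case by blast
  qed
qed

text \<open>Applying \<open>k\<close> letterwise conjugates the automaton maps to
  \<open>run\<close>; this carries torsion to the Boolean model and finiteness back.\<close>

lemma finite_automaton_group_transfer:
  fixes A :: "('q::finite, 'x::finite) automaton" and h :: "state \<Rightarrow> 'q" and k :: "'x \<Rightarrow> bool"
  defines "act \<equiv> \<lambda>s. k (out_letter A (h s) (inv_into UNIV k False))"
    and "nxt \<equiv> \<lambda>s b. inv_into UNIV h (next_state A (h s) (inv_into UNIV k b))"
  assumes h: "bij h" and k: "bij k" and A: "invertible_automaton A"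
    and t: "torsion_group (automaton_group A)"
    and fin: "torsion_on act nxt \<Longrightarrow> finite (range (run act nxt))"
  shows "finite (carrier (automaton_group A))"
proof -
  have inv_k [simp]: "inv_into UNIV k (k x) = x" "k (inv_into UNIV k b) = b" for x b
    using k by (simp_all add: bij_is_inj bij_is_surj surj_f_inv_f)
  have inv_h [simp]: "inv_into UNIV h (h s) = s" "h (inv_into UNIV h q) = q" for s q
    using h by (simp_all add: bij_is_inj bij_is_surj surj_f_inv_f)
  \<comment> \<open>A permutation of two letters is determined by the image of one of them, here the
    letter coded \<open>False\<close>.\<close>
  have out: "k (out_letter A (h s) x) = (k x \<noteq> act s)" for s x
  proof -
    have "out_letter A (h s) (inv_into UNIV k True) \<noteq> out_letter A (h s) (inv_into UNIV k False)"
      using A inv_k(2) unfolding invertible_automaton_def by (metis bij_pointE)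
    then have "k (out_letter A (h s) (inv_into UNIV k True)) \<noteq> k (out_letter A (h s) (inv_into UNIV k False))"
      by (metis inv_k(1))
    moreover have "x = inv_into UNIV k (k x)" by simp
    ultimately show ?thesis unfolding act_def by (cases "k x") metis+
  qed
  have next_state: "next_state A (h s) x = h (nxt s (k x))" for s x
    by (simp add: nxt_def)
  have sm: "map k (state_map A (h s) w) = smap act nxt s (map k w)" for s w
    by (induction w arbitrary: s) (simp_all add: out next_state)
  have sr: "map k (state_run A (map h ws) w) = run act nxt ws (map k w)" for ws w
    by (induction ws arbitrary: w) (auto simp: state_run_def sm)
  have mk: "map k (map (inv_into UNIV k) v) = v" "map (inv_into UNIV k) (map k w) = w" for v w
    by (simp_all add: comp_def)
  have "torsion_on act nxt"
    unfolding torsion_on_def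
  proof
    fix ws
    obtain n where n: "n > 0" "state_run A (map h ws) ^^ n = id"
      using torsion_state_run[OF t] by blast
    have "map k ((state_run A (map h ws) ^^ n) w) = (run act nxt ws ^^ n) (map k w)" for n w
      by (induction n) (auto simp: sr)
    then have "(run act nxt ws ^^ n) v = id v" for v
      using n(2) mk(1)[of v] by (metis id_apply)
    then have "run act nxt ws ^^ n = id" by (rule ext)
    then show "\<exists>n>0. run act nxt ws ^^ n = id" using n(1) by blast
  qed
  then have "finite ((\<lambda>f. map (inv_into UNIV k) \<circ> f \<circ> map k) ` range (run act nxt))"
    using fin by blast
  moreover have "state_run A qs \<in> (\<lambda>f. map (inv_into UNIV k) \<circ> f \<circ> map k) ` range (run act nxt)" for qs
  proof -
    have "map h (map (inv_into UNIV h) qs) = qs" by (simp add: comp_def)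
    then have "state_run A qs w = map (inv_into UNIV k) (run act nxt (map (inv_into UNIV h) qs) (map k w))" for w
      by (metis sr mk(2))
    then have "state_run A qs = map (inv_into UNIV k) \<circ> run act nxt (map (inv_into UNIV h) qs) \<circ> map k"
      by (simp add: fun_eq_iff)
    then show ?thesis by blast
  qed
  ultimately have "finite (range (state_run A))"
    by (meson finite_subset image_subsetI)
  then show ?thesis
    using carrier_automaton_group_torsion[OF A t] finite_subset by blast
qed

text \<open>Used to order the states by activity, which leaves only two nonconstant
  patterns.\<close>

lemma card_3_sorted:
  assumes "card S = 3"
  shows "\<exists>x y z. S = {x, y, z} \<and> distinct [x, y, z] \<and> (P x \<longrightarrow> P y) \<and> (P y \<longrightarrow> P z)"
proof -
  obtain x y z where S: "S = {x, y, z}" "x \<noteq> y" "x \<noteq> z" "y \<noteq> z"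
    using assms by (auto simp: card_3_iff)
  have perm: "S = {x, z, y}" "S = {y, x, z}" "S = {y, z, x}" "S = {z, x, y}" "S = {z, y, x}"
    using S(1) by auto
  show ?thesis
  proof (cases "P x"; cases "P y"; cases "P z")
  qed (use S perm in \<open>metis distinct_length_2_or_more distinct_singleton\<close>)+
qed

theorem theorem6:
  fixes A :: "('q::finite, 'x::finite) automaton"
  assumes "CARD('q) = 3" and "CARD('x) = 2"
    and "invertible_automaton A"
    and "torsion_group (automaton_group A)"
  shows "finite (carrier (automaton_group A))"
proof -
  have "CARD('x) = CARD(bool)" using assms(2) by simp
  then obtain k :: "'x \<Rightarrow> bool" where k: "bij k"
    using finite_same_card_bij[OF finite finite] by blast
  define a where "a q = k (out_letter A q (inv_into UNIV k False))" for q
  obtain x y z where U: "UNIV = {x, y, z}" "distinct [x, y, z]" and s: "a x \<longrightarrow> a y" "a y \<longrightarrow> a z"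
    using card_3_sorted[OF assms(1), of a] by blast
  define h where "h = case_state x y z"
  have "bij h"
  proof (rule bijI)
    show "inj h"
    proof (rule injI)
      fix s t assume "h s = h t" then show "s = t"
        using U(2) by (cases s; cases t) (auto simp: h_def)
    qed
    have "{x, y, z} \<subseteq> range h"
      using rangeI[of h S0] rangeI[of h S1] rangeI[of h S2] by (simp add: h_def)
    then show "surj h" using U(1) by auto
  qed
  then show ?thesis
    by (rule finite_automaton_group_transfer[OF _ k assms(3,4)])
      (rule torsion_imp_finite, use s in \<open>auto simp: h_def a_def\<close>)
qed

end
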